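(* Let $f:\mathbb{R}^p\to\mathbb{R}\cup\{\infty\}$ and $g:\mathbb{R}^q\to\mathbb{R}\cup\{\infty\}$ be closed, proper, convex functions, $A\in\mathbb{R}^{n\times p}$, $B\in\mathbb{R}^{n\times q}$, $c\in\mathbb{R}^n$, $\gamma>0$, and assume \[ (\mathrm{range}\,A^T)\cap\mathrm{ri}\,\mathrm{dom}(f^* )\neq\emptyset,\qquad (\mathrm{range}\,B^T)\cap\mathrm{ri}\,\mathrm{dom}(g^* )\neq\emptyset . \] Let $(x^k,y^k,\nu^k)$, $k\ge1$, be any sequence generated by ADMM. Suppose $d^\star=p^\star$, the primal problem (P-ADMM) has a solution, and the dual problem (D-ADMM) has no solution. Then $Ax^k+By^k-c\to 0$ and \[ \lim_{k\to\infty}\frac1k\sum_{i=1}^{k}\bigl(f(x^i)+g(y^i)\bigr)=p^\star,\qquad \liminf_{k\to\infty}\bigl(f(x^k)+g(y^k)\bigr)=p^\star . \] Furthermore, if $(x^k,y^k)\to(x^\star,y^\star)$ for some $(x^\star,y^\star)$, then $(x^\star,y^\star)$ is a solution of (P-ADMM).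
   Context: A convex function is closed if its epigraph is closed, and proper if it is finite somewhere. $\mathrm{dom}$ is the effective domain (where the function is $<\infty$), $\mathrm{ri}$ the relative interior, and $f^*(\nu)=\sup_x\{\langle\nu,x\rangle-f(x)\}$ the convex conjugate. (P-ADMM): minimize $f(x)+g(y)$ over $x\in\mathbb{R}^p,y\in\mathbb{R}^q$ subject to $Ax+By=c$; its optimal value is $p^\star\in[-\infty,\infty]$ ($p^\star=\infty$ if infeasible, i.e. if no $x\in\mathrm{dom} f$, $y\in\mathrm{dom} g$ satisfy $Ax+By=c$). A solution of (P-ADMM) is a feasible point attaining $p^\star$. (D-ADMM): maximize $-f^*(-A^T\nu)-g^*(-B^T\nu)-c^T\nu$ over $\nu\in\mathbb{R}^n$; its optimal value is $d^\star\in[-\infty,\infty]$ ($d^\star=-\infty$ if infeasible). A solution of (D-ADMM) is a feasible point attaining $d^\star$. ADMM, with arbitrary starting $y^0\in\mathbb{R}^q$, $\nu^0\in\mathbb{R}^n$, is, for $k=0,1,\dots$: $x^{k+1}\in\arg\min_{x}\{f(x)+\langle\nu^k,Ax+By^k-c\rangle+\frac{1}{2\gamma}\|Ax+By^k-c\|^2\}$, $y^{k+1}\in\arg\min_{y}\{g(y)+\langle\nu^k,Ax^{k+1}+By-c\rangle+\frac{1}{2\gamma}\|Ax^{k+1}+By-c\|^2\}$, $\nu^{k+1}=\nu^k+\frac1\gamma(Ax^{k+1}+By^{k+1}-c)$. (The relative-interior conditions ensure that the argmins are nonempty; any selection of minimizers is allowed.) *)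

theory Defs
  imports "HOL-Analysis.Analysis"
begin

text \<open>
  Functions into \<open>\<real> \<union> {\<infinity>}\<close> are modelled as \<^typ>\<open>ereal\<close>-valued functions; that the
  value \<open>-\<infinity>\<close> is not taken is a separate hypothesis wherever it is needed.
\<close>

definition epi :: "('a \<Rightarrow> ereal) \<Rightarrow> ('a \<times> real) set" where
  "epi f = {(x, t). f x \<le> ereal t}"

definition convex_fun :: "('a::real_vector \<Rightarrow> ereal) \<Rightarrow> bool" where
  "convex_fun f \<longleftrightarrow> convex (epi f)"

definition closed_fun :: "('a::topological_space \<Rightarrow> ereal) \<Rightarrow> bool" where
  "closed_fun f \<longleftrightarrow> closed (epi f)"

definition proper_fun :: "('a \<Rightarrow> ereal) \<Rightarrow> bool" where
  "proper_fun f \<longleftrightarrow> (\<exists>x. \<bar>f x\<bar> \<noteq> \<infinity>)"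

definition eff_dom :: "('a \<Rightarrow> ereal) \<Rightarrow> 'a set" where
  "eff_dom f = {x. f x < \<infinity>}"

definition conjugate :: "('a::real_inner \<Rightarrow> ereal) \<Rightarrow> 'a \<Rightarrow> ereal" where
  "conjugate f \<nu> = (SUP x. ereal (\<nu> \<bullet> x) - f x)"

definition primal_feasible ::
    "(real^'p \<Rightarrow> ereal) \<Rightarrow> (real^'q \<Rightarrow> ereal) \<Rightarrow> real^'p^'n \<Rightarrow> real^'q^'n \<Rightarrow> real^'n
      \<Rightarrow> ((real^'p) \<times> (real^'q)) set" where
  "primal_feasible f g A B c =
     {(x, y). x \<in> eff_dom f \<and> y \<in> eff_dom g \<and> A *v x + B *v y = c}"

definition primal_value ::
    "(real^'p \<Rightarrow> ereal) \<Rightarrow> (real^'q \<Rightarrow> ereal) \<Rightarrow> real^'p^'n \<Rightarrow> real^'q^'n \<Rightarrow> real^'n \<Rightarrow> ereal" where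
  "primal_value f g A B c = (INF (x, y)\<in>primal_feasible f g A B c. f x + g y)"

definition primal_solution ::
    "(real^'p \<Rightarrow> ereal) \<Rightarrow> (real^'q \<Rightarrow> ereal) \<Rightarrow> real^'p^'n \<Rightarrow> real^'q^'n \<Rightarrow> real^'n
      \<Rightarrow> real^'p \<Rightarrow> real^'q \<Rightarrow> bool" where
  "primal_solution f g A B c x y \<longleftrightarrow>
     (x, y) \<in> primal_feasible f g A B c \<and> f x + g y = primal_value f g A B c"

text \<open>
  For proper \<open>f\<close> and \<open>g\<close> the conjugates do not take the value \<open>-\<infinity>\<close>, so the dual objective
  never involves \<open>\<infinity> - \<infinity>\<close>.
\<close>

definition dual_objective ::
    "(real^'p \<Rightarrow> ereal) \<Rightarrow> (real^'q \<Rightarrow> ereal) \<Rightarrow> real^'p^'n \<Rightarrow> real^'q^'n \<Rightarrow> real^'n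
      \<Rightarrow> real^'n \<Rightarrow> ereal" where
  "dual_objective f g A B c \<nu> =
     - conjugate f (- (transpose A *v \<nu>)) - conjugate g (- (transpose B *v \<nu>)) - ereal (c \<bullet> \<nu>)"

definition dual_feasible ::
    "(real^'p \<Rightarrow> ereal) \<Rightarrow> (real^'q \<Rightarrow> ereal) \<Rightarrow> real^'p^'n \<Rightarrow> real^'q^'n \<Rightarrow> (real^'n) set" where
  "dual_feasible f g A B =
     {\<nu>. - (transpose A *v \<nu>) \<in> eff_dom (conjugate f) \<and>
         - (transpose B *v \<nu>) \<in> eff_dom (conjugate g)}"

definition dual_value ::
    "(real^'p \<Rightarrow> ereal) \<Rightarrow> (real^'q \<Rightarrow> ereal) \<Rightarrow> real^'p^'n \<Rightarrow> real^'q^'n \<Rightarrow> real^'n \<Rightarrow> ereal" where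
  "dual_value f g A B c = (SUP \<nu>\<in>dual_feasible f g A B. dual_objective f g A B c \<nu>)"

definition dual_solution ::
    "(real^'p \<Rightarrow> ereal) \<Rightarrow> (real^'q \<Rightarrow> ereal) \<Rightarrow> real^'p^'n \<Rightarrow> real^'q^'n \<Rightarrow> real^'n
      \<Rightarrow> real^'n \<Rightarrow> bool" where
  "dual_solution f g A B c \<nu> \<longleftrightarrow>
     \<nu> \<in> dual_feasible f g A B \<and> dual_objective f g A B c \<nu> = dual_value f g A B c"

definition aug_term :: "real \<Rightarrow> 'a::real_inner \<Rightarrow> 'a \<Rightarrow> real" where
  "aug_term \<gamma> \<nu> r = \<nu> \<bullet> r + 1 / (2 * \<gamma>) * (norm r)\<^sup>2"

text \<open>
  The starting points \<open>y 0\<close> and \<open>\<nu> 0\<close> are arbitrary and any choice of minimizers is allowed;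
  \<open>x 0\<close> is not constrained and plays no role.
\<close>

definition admm_iterates ::
    "(real^'p \<Rightarrow> ereal) \<Rightarrow> (real^'q \<Rightarrow> ereal) \<Rightarrow> real^'p^'n \<Rightarrow> real^'q^'n \<Rightarrow> real^'n \<Rightarrow> real
      \<Rightarrow> (nat \<Rightarrow> real^'p) \<Rightarrow> (nat \<Rightarrow> real^'q) \<Rightarrow> (nat \<Rightarrow> real^'n) \<Rightarrow> bool" where
  "admm_iterates f g A B c \<gamma> x y \<nu> \<longleftrightarrow>
     (\<forall>k. is_arg_min (\<lambda>u. f u + ereal (aug_term \<gamma> (\<nu> k) (A *v u + B *v y k - c)))
            (\<lambda>_. True) (x (Suc k)) \<and>
          is_arg_min (\<lambda>v. g v + ereal (aug_term \<gamma> (\<nu> k) (A *v x (Suc k) + B *v v - c)))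
            (\<lambda>_. True) (y (Suc k)) \<and>
          \<nu> (Suc k) = \<nu> k + (1 / \<gamma>) *\<^sub>R (A *v x (Suc k) + B *v y (Suc k) - c))"

end

theory Submission
  imports Defs
begin

text \<open>
  Write \<open>r k\<close> for the residual \<open>A x\<^sup>k + B y\<^sup>k - c\<close>, fix a primal solution \<open>(u, v)\<close> with value \<open>p\<close>,
  and for a multiplier \<open>\<mu>\<close> let
  \<open>E k = (\<gamma> \<bar>\<nu>\<^sup>k - \<mu>\<bar>\<^sup>2 + \<bar>B y\<^sup>k - B v\<bar>\<^sup>2 / \<gamma>) / 2\<close>. The usual energy argument for ADMM takes \<open>\<mu>\<close> to be a
  dual solution. Here none exists, so \<open>\<mu>\<close> is kept arbitrary. The optimality conditions of the two
  minimizations, tested at \<open>(u, v)\<close>, give for \<open>k \<ge> 1\<close>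
  \<open>f(x\<^sup>k\<^sup>+\<^sup>1) + g(y\<^sup>k\<^sup>+\<^sup>1) + \<mu> \<bullet> r (k+1) - p + E (k+1) + S k / 2 \<le> E k\<close>,
  where \<open>S k = \<gamma> \<bar>\<nu>\<^sup>k\<^sup>+\<^sup>1 - \<nu>\<^sup>k\<bar>\<^sup>2 + \<bar>B y\<^sup>k\<^sup>+\<^sup>1 - B y\<^sup>k\<bar>\<^sup>2 / \<gamma>\<close>; this is \<open>energy_inequality\<close>. The theorem follows
  from it by two choices of \<open>\<mu>\<close>.

  First, strong duality supplies for every \<open>\<epsilon> > 0\<close> a \<open>\<mu>\<close> whose dual value exceeds \<open>p - \<epsilon>\<close>, and then
  \<open>f(x) + g(y) + \<mu> \<bullet> (A x + B y - c) \<ge> p - \<epsilon>\<close> for all \<open>x\<close> and \<open>y\<close> by weak duality. Hence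
  \<open>E (k+1) + S k / 2 \<le> E k + \<epsilon>\<close>, so the averages of \<open>S\<close> are eventually at most \<open>3 \<epsilon>\<close>.
  Since \<open>S\<close> is nonincreasing (\<open>step_size_Suc_le\<close>: one ADMM step does not expand
  distances), \<open>S\<close> itself tends to \<open>0\<close>, and with it \<open>r k = \<gamma> (\<nu>\<^sup>k - \<nu>\<^sup>k\<^sup>-\<^sup>1)\<close>. Using weak duality again,
  now with \<open>\<mu> \<bullet> r k\<close> tending to \<open>0\<close>, the objective values have limit inferior at least \<open>p\<close>.

  Second, \<open>\<mu> = 0\<close> makes the residual term disappear, and summing the inequality bounds the sum of
  the first \<open>k\<close> objective values by \<open>k p\<close> plus a constant. A sequence whose limit inferior is at
  least \<open>p\<close> and whose averages have limit superior at most \<open>p\<close> has averages tending to \<open>p\<close> and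
  limit inferior equal to \<open>p\<close> (\<open>average_and_liminf_eq\<close>). Lower semicontinuity of \<open>f\<close> and \<open>g\<close> settles
  the claim about a limit of the iterates.
\<close>

section \<open>Averages and limit inferior of a real sequence\<close>

lemma sum_ge_of_eventually_ge:
  fixes s :: "nat \<Rightarrow> real"
  assumes "eventually (\<lambda>i. q \<le> s i) sequentially"
  shows "\<exists>C. \<forall>k. real k * q - C \<le> (\<Sum>i=1..k. s i)"
proof -
  obtain N where N: "\<And>i. i \<ge> N \<Longrightarrow> q \<le> s i"
    using assms by (auto simp: eventually_sequentially)
  \<comment> \<open>the terms up to \<open>N\<close> are corrected by the amount by which they may fall below \<open>q\<close>\<close>
  define d where "d i = (if i \<le> N then \<bar>s i - q\<bar> else 0)" for i
  have "real k * q - (\<Sum>i\<le>N. d i) \<le> (\<Sum>i=1..k. s i)" for k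
  proof -
    have "(\<Sum>i=1..k. q - d i) \<le> (\<Sum>i=1..k. s i)"
      by (intro sum_mono) (use N in \<open>force simp: d_def\<close>)
    moreover have "(\<Sum>i=1..k. d i) = (\<Sum>i\<in>{1..k} \<inter> {..N}. d i)"
      by (intro sum.mono_neutral_right) (auto simp: d_def)
    moreover have "\<dots> \<le> (\<Sum>i\<le>N. d i)"
      by (intro sum_mono2) (auto simp: d_def)
    ultimately show ?thesis by (simp add: sum_subtractf)
  qed
  then show ?thesis by blast
qed

text \<open>
  The lower bound alone controls the averages from below, because finitely many terms do not affect
  them. If the limit inferior were some number above \<open>p\<close>, the averages would exceed \<open>p\<close> as well,
  against the upper bound.
\<close>

lemma average_and_liminf_eq:
  fixes s :: "nat \<Rightarrow> real"
  assumes lower: "\<And>q. q < p \<Longrightarrow> eventually (\<lambda>i. q \<le> s i) sequentially"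
    and upper: "\<And>k. (\<Sum>i=1..k. s i) \<le> real k * p + C"
  shows "(\<lambda>k. 1 / real k * (\<Sum>i=1..k. s i)) \<longlonglongrightarrow> p"
    and "liminf (\<lambda>k. ereal (s k)) = ereal p"
proof -
  have lin: "(\<lambda>k. a + D / real k) \<longlonglongrightarrow> a" for a D :: real
    using tendsto_add[OF tendsto_const[of a] lim_const_over_n[of D]] by simp
  show "(\<lambda>k. 1 / real k * (\<Sum>i=1..k. s i)) \<longlonglongrightarrow> p"
  proof (rule order_tendstoI)
    fix a assume "a < p"
    define q where "q = (a + p) / 2"
    have q: "a < q" "q < p" using \<open>a < p\<close> by (auto simp: q_def)
    obtain D where D: "\<And>k. real k * q - D \<le> (\<Sum>i=1..k. s i)"
      using sum_ge_of_eventually_ge[OF lower[OF q(2)]] by blast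
    have "eventually (\<lambda>k. a < q + (- D) / real k) sequentially"
      using order_tendstoD(1)[OF lin q(1)] .
    then show "eventually (\<lambda>k. a < 1 / real k * (\<Sum>i=1..k. s i)) sequentially"
      using eventually_gt_at_top[of 0]
    proof eventually_elim
      case (elim k)
      have "q + (- D) / real k = 1 / real k * (real k * q - D)"
        using elim by (simp add: field_simps)
      also have "\<dots> \<le> 1 / real k * (\<Sum>i=1..k. s i)"
        by (intro mult_left_mono D) auto
      finally show ?case using elim by linarith
    qed
  next
    fix a assume "p < a"
    have "eventually (\<lambda>k. p + C / real k < a) sequentially"
      using order_tendstoD(2)[OF lin \<open>p < a\<close>] .
    then show "eventually (\<lambda>k. 1 / real k * (\<Sum>i=1..k. s i) < a) sequentially"
      using eventually_gt_at_top[of 0]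
    proof eventually_elim
      case (elim k)
      have "1 / real k * (\<Sum>i=1..k. s i) \<le> 1 / real k * (real k * p + C)"
        by (intro mult_left_mono upper) auto
      also have "\<dots> = p + C / real k"
        using elim by (simp add: field_simps)
      finally show ?case using elim by linarith
    qed
  qed
  show "liminf (\<lambda>k. ereal (s k)) = ereal p"
  proof (rule antisym)
    show "liminf (\<lambda>k. ereal (s k)) \<le> ereal p"
    proof (rule ccontr)
      assume "\<not> liminf (\<lambda>k. ereal (s k)) \<le> ereal p"
      then obtain q where q: "ereal p < ereal q" "ereal q < liminf (\<lambda>k. ereal (s k))"
        using ereal_dense2 by (metis not_le)
      have "eventually (\<lambda>k. q \<le> s k) sequentially"
        using less_LiminfD[OF q(2)] by (auto elim: eventually_mono)
      then obtain D where D: "\<And>k. real k * q - D \<le> (\<Sum>i=1..k. s i)"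
        using sum_ge_of_eventually_ge by blast
      obtain k :: nat where "(C + D) < real k * (q - p)"
        using q(1) reals_Archimedean3[of "q - p"] by auto
      then show False
        using D[of k] upper[of k] by (simp add: algebra_simps)
    qed
    show "ereal p \<le> liminf (\<lambda>k. ereal (s k))"
      unfolding le_Liminf_iff
    proof (intro allI impI)
      fix z assume "z < ereal p"
      then obtain q where q: "z < ereal q" "ereal q < ereal p"
        using ereal_dense2 by blast
      show "eventually (\<lambda>k. z < ereal (s k)) sequentially"
        using lower[of q] q by (auto elim!: eventually_mono intro: less_le_trans)
    qed
  qed
qed

section \<open>Extended-real convex functions\<close>

text \<open>
  If \<open>q\<close> lies below \<open>f l\<close>, then \<open>(l, q)\<close> is in the open complement of the epigraph, and so is
  \<open>(X k, q)\<close> for all large \<open>k\<close>.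
\<close>

lemma closed_fun_le_liminf:
  fixes f :: "'a::metric_space \<Rightarrow> ereal"
  assumes "closed_fun f" and "X \<longlonglongrightarrow> l"
  shows "f l \<le> liminf (\<lambda>k. f (X k))"
  unfolding le_Liminf_iff
proof (intro allI impI)
  fix z assume "z < f l"
  then obtain q where q: "z < ereal q" "ereal q < f l"
    using ereal_dense2 by blast
  have "open (- epi f)" using assms(1) by (simp add: closed_fun_def open_Compl)
  moreover have "(l, q) \<in> - epi f" using q by (auto simp: epi_def)
  moreover have "(\<lambda>k. (X k, q)) \<longlonglongrightarrow> (l, q)" by (intro tendsto_Pair assms tendsto_const)
  ultimately have "eventually (\<lambda>k. (X k, q) \<in> - epi f) sequentially"
    using topological_tendstoD by blast
  then show "eventually (\<lambda>k. z < f (X k)) sequentially"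
    using q(1) by (auto elim!: eventually_mono simp: epi_def)
qed

lemma convex_fun_segment_le:
  fixes h :: "'a::real_vector \<Rightarrow> ereal"
  assumes "convex_fun h" and "h w = ereal a" and "h u = ereal s" and "0 \<le> t" "t \<le> 1"
  shows "h (w + t *\<^sub>R (u - w)) \<le> ereal (a + t * (s - a))"
proof -
  have "(1 - t) *\<^sub>R (w, a) + t *\<^sub>R (u, s) \<in> epi h"
    using assms unfolding convex_fun_def
    by (intro convexD) (auto simp: epi_def)
  moreover have "(1 - t) *\<^sub>R (w, a) + t *\<^sub>R (u, s) = (w + t *\<^sub>R (u - w), a + t * (s - a))"
    by (simp add: algebra_simps)
  ultimately show ?thesis by (simp add: epi_def)
qed

lemma aug_term_add:
  "aug_term \<gamma> \<nu> (r + t *\<^sub>R d) =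
     aug_term \<gamma> \<nu> r + t * ((\<nu> + (1 / \<gamma>) *\<^sub>R r) \<bullet> d) + t\<^sup>2 * (1 / (2 * \<gamma>) * (norm d)\<^sup>2)"
  unfolding aug_term_def power2_norm_eq_inner
  by (simp add: inner_simps inner_commute algebra_simps add_divide_distrib power2_eq_square)

text \<open>
  Fermat's rule for a convex function plus a smooth quadratic. Comparing the minimizer \<open>w\<close> with
  \<open>w + t (u - w)\<close> and using convexity of \<open>h\<close> on the segment leaves an inequality with an error
  linear in \<open>t\<close>; letting \<open>t\<close> tend to \<open>0\<close> shows that the negative gradient of the quadratic is a
  subgradient of \<open>h\<close> at \<open>w\<close>. The value at \<open>w\<close> is finite because \<open>h\<close> is finite somewhere.
\<close>

lemma arg_min_aug_term_subgradient:
  fixes h :: "real^'m \<Rightarrow> ereal" and M :: "real^'m^'n" and d \<nu> :: "real^'n"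
  assumes "\<And>u. h u \<noteq> -\<infinity>" and "proper_fun h" and "convex_fun h"
    and min: "is_arg_min (\<lambda>u. h u + ereal (aug_term \<gamma> \<nu> (M *v u + d))) (\<lambda>_. True) w"
  shows "\<exists>a. h w = ereal a \<and>
      (\<forall>u s. h u = ereal s \<longrightarrow>
         a - (\<nu> + (1 / \<gamma>) *\<^sub>R (M *v w + d)) \<bullet> (M *v u - M *v w) \<le> s)"
proof -
  have le: "h w + ereal (aug_term \<gamma> \<nu> (M *v w + d)) \<le> h u + ereal (aug_term \<gamma> \<nu> (M *v u + d))" for u
    using min by (auto simp: is_arg_min_def not_less)
  obtain u0 r where "h u0 = ereal r" using assms(2) by (auto simp: proper_fun_def)
  then have "h w \<noteq> \<infinity>" using le[of u0] by auto
  then obtain a where a: "h w = ereal a" using assms(1)[of w] by (cases "h w") auto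
  have "a - (\<nu> + (1 / \<gamma>) *\<^sub>R (M *v w + d)) \<bullet> (M *v u - M *v w) \<le> s" if u: "h u = ereal s" for u s
  proof -
    define e where "e = M *v u - M *v w"
    define D where "D = (\<nu> + (1 / \<gamma>) *\<^sub>R (M *v w + d)) \<bullet> e"
    define Q where "Q = 1 / (2 * \<gamma>) * (norm e)\<^sup>2"
    have ineq: "a \<le> s + D + t * Q" if t: "0 < t" "t < 1" for t
    proof -
      have "M *v (w + t *\<^sub>R (u - w)) + d = (M *v w + d) + t *\<^sub>R e"
        by (simp add: e_def matrix_vector_right_distrib matrix_vector_mult_diff_distrib
            matrix_vector_mult_scaleR)
      then have aug: "aug_term \<gamma> \<nu> (M *v (w + t *\<^sub>R (u - w)) + d)
          = aug_term \<gamma> \<nu> (M *v w + d) + t * D + t\<^sup>2 * Q"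
        by (simp only: aug_term_add D_def Q_def)
      have "h w + ereal (aug_term \<gamma> \<nu> (M *v w + d))
          \<le> ereal (a + t * (s - a)) + ereal (aug_term \<gamma> \<nu> (M *v w + d) + t * D + t\<^sup>2 * Q)"
        using le[of "w + t *\<^sub>R (u - w)"] convex_fun_segment_le[OF assms(3) a u, of t] t
        unfolding aug by (meson add_right_mono less_imp_le order_trans)
      then have "0 \<le> t * (s - a) + t * D + t\<^sup>2 * Q" by (simp add: a)
      also have "\<dots> = t * (s - a + D + t * Q)" by (simp add: algebra_simps power2_eq_square)
      finally show ?thesis using t by (simp add: zero_le_mult_iff)
    qed
    have "a \<le> s + D + 0 * Q"
    proof (rule tendsto_lowerbound)
      show "((\<lambda>t. s + D + t * Q) \<longlongrightarrow> s + D + 0 * Q) (at_right 0)"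
        by (intro tendsto_intros)
      show "eventually (\<lambda>t. a \<le> s + D + t * Q) (at_right 0)"
        using ineq by (auto simp: eventually_at_right[of 0 1] intro!: exI[of _ 1])
    qed auto
    then show ?thesis by (simp add: D_def e_def)
  qed
  with a show ?thesis by blast
qed

section \<open>Weak duality\<close>

lemma Fenchel_Young:
  "h w = ereal a \<Longrightarrow> ereal (z \<bullet> w - a) \<le> conjugate h z"
  unfolding conjugate_def by (rule SUP_upper2[of w]) auto

lemma dual_objective_le_lagrangian:
  fixes f :: "real^'p \<Rightarrow> ereal" and g :: "real^'q \<Rightarrow> ereal"
    and A :: "real^'p^'n" and B :: "real^'q^'n"
  assumes "f u = ereal s" and "g v = ereal t"
  shows "dual_objective f g A B c \<mu> \<le> ereal (s + t + \<mu> \<bullet> (A *v u + B *v v - c))"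
proof -
  have 1: "- conjugate f (- (transpose A *v \<mu>)) \<le> ereal (s + \<mu> \<bullet> (A *v u))"
  proof -
    have "- (transpose A *v \<mu>) \<bullet> u - s = - (s + \<mu> \<bullet> (A *v u))"
      by (simp add: dot_lmul_matrix)
    then show ?thesis
      using Fenchel_Young[where h=f, OF assms(1), of "- (transpose A *v \<mu>)"]
      by (metis ereal_uminus_le_reorder uminus_ereal.simps(1))
  qed
  have 2: "- conjugate g (- (transpose B *v \<mu>)) \<le> ereal (t + \<mu> \<bullet> (B *v v))"
  proof -
    have "- (transpose B *v \<mu>) \<bullet> v - t = - (t + \<mu> \<bullet> (B *v v))"
      by (simp add: dot_lmul_matrix)
    then show ?thesis
      using Fenchel_Young[where h=g, OF assms(2), of "- (transpose B *v \<mu>)"]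
      by (metis ereal_uminus_le_reorder uminus_ereal.simps(1))
  qed
  have "dual_objective f g A B c \<mu>
      \<le> ereal (s + \<mu> \<bullet> (A *v u)) + ereal (t + \<mu> \<bullet> (B *v v)) + - ereal (c \<bullet> \<mu>)"
    unfolding dual_objective_def minus_ereal_def by (intro add_mono 1 2 order_refl)
  also have "\<dots> = ereal (s + t + \<mu> \<bullet> (A *v u + B *v v - c))"
    by (simp add: inner_simps inner_commute)
  finally show ?thesis .
qed

section \<open>Energy estimates along an ADMM run\<close>

lemma inner_diff_diff_polarization:
  fixes a m n :: "'a::real_inner"
  shows "(a - m) \<bullet> (a - n) = ((norm (a - m))\<^sup>2 + (norm (a - n))\<^sup>2 - (norm (n - m))\<^sup>2) / 2"
  by (simp add: power2_norm_eq_inner inner_simps inner_commute)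

lemma inner_le_weighted_squares:
  fixes p q :: "'a::real_inner"
  assumes "\<gamma> > 0"
  shows "2 * (q \<bullet> p) \<le> \<gamma> * (norm p)\<^sup>2 + (norm q)\<^sup>2 / \<gamma>"
proof -
  have "0 \<le> (norm (\<gamma> *\<^sub>R p - q))\<^sup>2 / \<gamma>" using assms by simp
  also have "\<dots> = \<gamma> * (norm p)\<^sup>2 + (norm q)\<^sup>2 / \<gamma> - 2 * (q \<bullet> p)"
    using assms unfolding power2_norm_eq_inner
    by (simp add: inner_diff_left inner_diff_right inner_commute field_simps)
  finally show ?thesis by simp
qed

locale admm_run =
  fixes f :: "real^'p \<Rightarrow> ereal" and g :: "real^'q \<Rightarrow> ereal"
    and A :: "real^'p^'n" and B :: "real^'q^'n" and c :: "real^'n" and \<gamma> :: real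
    and x :: "nat \<Rightarrow> real^'p" and y :: "nat \<Rightarrow> real^'q" and \<nu> :: "nat \<Rightarrow> real^'n"
  assumes f_not_MInfty: "\<And>u. f u \<noteq> -\<infinity>" and f_proper: "proper_fun f" and f_convex: "convex_fun f"
    and g_not_MInfty: "\<And>v. g v \<noteq> -\<infinity>" and g_proper: "proper_fun g" and g_convex: "convex_fun g"
    and \<gamma>_pos: "\<gamma> > 0"
    and iterates: "admm_iterates f g A B c \<gamma> x y \<nu>"
begin

definition residual :: "nat \<Rightarrow> real^'n" where
  "residual k = A *v x k + B *v y k - c"

text \<open>
  The conversion to reals is faithful from the first iterate on (\<open>objective_iterate\<close>); the
  values at \<open>x 0\<close> and \<open>y 0\<close> may be infinite.
\<close>

definition objective :: "nat \<Rightarrow> real" where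
  "objective k = real_of_ereal (f (x k)) + real_of_ereal (g (y k))"

text \<open>
  Only \<open>\<nu>\<close> and \<open>B y\<close> carry over from one ADMM step to the next, so step sizes and energies measure
  these two.
\<close>

definition step_size :: "nat \<Rightarrow> real" where
  "step_size k = \<gamma> * (norm (\<nu> (Suc k) - \<nu> k))\<^sup>2 + (norm (B *v y (Suc k) - B *v y k))\<^sup>2 / \<gamma>"

definition energy :: "real^'n \<Rightarrow> real^'q \<Rightarrow> nat \<Rightarrow> real" where
  "energy \<mu> v k = (\<gamma> * (norm (\<nu> k - \<mu>))\<^sup>2 + (norm (B *v y k - B *v v))\<^sup>2 / \<gamma>) / 2"

lemma energy_nonneg: "0 \<le> energy \<mu> v k"
  using \<gamma>_pos by (simp add: energy_def)

lemma residual_Suc: "residual (Suc k) = \<gamma> *\<^sub>R (\<nu> (Suc k) - \<nu> k)"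
  using iterates \<gamma>_pos unfolding admm_iterates_def residual_def by simp

text \<open>
  The \<open>x\<close>-step still sees the old \<open>y\<close>. Expressed through the new multiplier, its subgradient is
  therefore \<open>- A\<^sup>T \<nu>\<^sup>k\<^sup>+\<^sup>1\<close> with a correction by the change of \<open>B y\<close>, whereas the \<open>y\<close>-step yields
  \<open>- B\<^sup>T \<nu>\<^sup>k\<^sup>+\<^sup>1\<close> exactly.
\<close>

lemma f_iterate:
  "f (x (Suc k)) = ereal (real_of_ereal (f (x (Suc k))))" (is ?finite)
  and f_subgradient: "f u = ereal s \<Longrightarrow>
      real_of_ereal (f (x (Suc k)))
        - (\<nu> (Suc k) + (1 / \<gamma>) *\<^sub>R (B *v y k - B *v y (Suc k))) \<bullet> (A *v u - A *v x (Suc k)) \<le> s"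
proof -
  have "is_arg_min (\<lambda>u. f u + ereal (aug_term \<gamma> (\<nu> k) (A *v u + (B *v y k - c))))
      (\<lambda>_. True) (x (Suc k))"
    using iterates by (simp add: admm_iterates_def algebra_simps)
  from arg_min_aug_term_subgradient[OF f_not_MInfty f_proper f_convex this]
  obtain a where a: "f (x (Suc k)) = ereal a"
    "\<And>u s. f u = ereal s \<Longrightarrow> a - (\<nu> k + (1 / \<gamma>) *\<^sub>R (A *v x (Suc k) + (B *v y k - c)))
        \<bullet> (A *v u - A *v x (Suc k)) \<le> s"
    by blast
  show ?finite by (simp add: a)
  have "\<nu> (Suc k) = \<nu> k + (1 / \<gamma>) *\<^sub>R (A *v x (Suc k) + B *v y (Suc k) - c)"
    using iterates by (simp add: admm_iterates_def)
  then have "\<nu> (Suc k) + (1 / \<gamma>) *\<^sub>R (B *v y k - B *v y (Suc k))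
      = \<nu> k + (1 / \<gamma>) *\<^sub>R (A *v x (Suc k) + (B *v y k - c))"
    by (simp add: scaleR_add_right scaleR_diff_right)
  then show "real_of_ereal (f (x (Suc k)))
        - (\<nu> (Suc k) + (1 / \<gamma>) *\<^sub>R (B *v y k - B *v y (Suc k))) \<bullet> (A *v u - A *v x (Suc k)) \<le> s"
    if "f u = ereal s"
    using a that by simp
qed

lemma g_iterate:
  "g (y (Suc k)) = ereal (real_of_ereal (g (y (Suc k))))" (is ?finite)
  and g_subgradient: "g v = ereal t \<Longrightarrow>
      real_of_ereal (g (y (Suc k))) - \<nu> (Suc k) \<bullet> (B *v v - B *v y (Suc k)) \<le> t"
proof -
  have "is_arg_min (\<lambda>v. g v + ereal (aug_term \<gamma> (\<nu> k) (B *v v + (A *v x (Suc k) - c))))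
      (\<lambda>_. True) (y (Suc k))"
    using iterates by (simp add: admm_iterates_def algebra_simps)
  from arg_min_aug_term_subgradient[OF g_not_MInfty g_proper g_convex this]
  obtain a where a: "g (y (Suc k)) = ereal a"
    "\<And>v t. g v = ereal t \<Longrightarrow> a - (\<nu> k + (1 / \<gamma>) *\<^sub>R (B *v y (Suc k) + (A *v x (Suc k) - c)))
        \<bullet> (B *v v - B *v y (Suc k)) \<le> t"
    by blast
  show ?finite by (simp add: a)
  have "\<nu> (Suc k) = \<nu> k + (1 / \<gamma>) *\<^sub>R (B *v y (Suc k) + (A *v x (Suc k) - c))"
    using iterates by (simp add: admm_iterates_def algebra_simps)
  then show "real_of_ereal (g (y (Suc k))) - \<nu> (Suc k) \<bullet> (B *v v - B *v y (Suc k)) \<le> t"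
    if "g v = ereal t"
    using a that by simp
qed

lemma objective_iterate: "f (x (Suc k)) + g (y (Suc k)) = ereal (objective (Suc k))"
  unfolding objective_def by (subst f_iterate, subst g_iterate) simp

text \<open>
  Monotonicity of the subdifferential of \<open>g\<close>, which contains \<open>- B\<^sup>T \<nu>\<^sup>k\<close> at \<open>y\<^sup>k\<close> only for \<open>k \<ge> 1\<close>. This is
  why the estimates below start at index \<open>1\<close>.
\<close>

lemma multiplier_step_inner_nonpos:
  "(\<nu> (Suc (Suc k)) - \<nu> (Suc k)) \<bullet> (B *v y (Suc (Suc k)) - B *v y (Suc k)) \<le> 0"
  using g_subgradient[OF g_iterate[of k], of "Suc k"] g_subgradient[OF g_iterate[of "Suc k"], of k]
  by (simp add: inner_simps)

text \<open>
  Adding the two subgradient inequalities at a feasible point \<open>(u, v)\<close> leaves inner products of the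
  form \<open>(a - m) \<bullet> (a - n)\<close>, which polarization turns into differences of energies. The one cross
  term, between the steps of \<open>\<nu>\<close> and \<open>B y\<close>, has a favourable sign by monotonicity. The vector \<open>\<mu>\<close> is
  free, since \<open>\<mu> \<bullet> r\<close> is added on both sides.
\<close>

lemma energy_inequality:
  assumes "f u = ereal s" and "g v = ereal t" and feasible: "A *v u + B *v v = c"
  shows "objective (Suc (Suc k)) + \<mu> \<bullet> residual (Suc (Suc k)) - (s + t)
      + energy \<mu> v (Suc (Suc k)) + step_size (Suc k) / 2 \<le> energy \<mu> v (Suc k)"
proof -
  define n m b b' r where defs: "n = \<nu> (Suc (Suc k))" "m = \<nu> (Suc k)"
    "b = B *v y (Suc (Suc k))" "b' = B *v y (Suc k)" "r = residual (Suc (Suc k))"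
  have Ax: "A *v u - A *v x (Suc (Suc k)) = - r - (B *v v - b)"
    using feasible by (auto simp: defs residual_def algebra_simps)
  have r: "r = \<gamma> *\<^sub>R (n - m)" by (simp add: defs residual_Suc)
  have "objective (Suc (Suc k)) - (s + t)
      \<le> (n + (1 / \<gamma>) *\<^sub>R (b' - b)) \<bullet> (- r - (B *v v - b)) + n \<bullet> (B *v v - b)"
    using f_subgradient[OF assms(1), of "Suc k"] g_subgradient[OF assms(2), of "Suc k"]
    by (simp add: objective_def Ax flip: defs)
  also have "\<dots> = - (n \<bullet> r) + (1 / \<gamma>) * ((b - b') \<bullet> r) - (1 / \<gamma>) * ((b - b') \<bullet> (b - B *v v))"
    by (simp add: inner_simps algebra_simps)
  also have "(1 / \<gamma>) * ((b - b') \<bullet> r) = (n - m) \<bullet> (b - b')"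
    using \<gamma>_pos by (simp add: r inner_commute)
  also have "\<dots> \<le> 0"
    using multiplier_step_inner_nonpos[of k] by (simp add: defs)
  finally have "objective (Suc (Suc k)) + \<mu> \<bullet> r - (s + t)
      \<le> - ((n - \<mu>) \<bullet> r) - (1 / \<gamma>) * ((b - B *v v) \<bullet> (b - b'))"
    by (simp add: inner_simps inner_commute)
  also have "\<dots> = - \<gamma> * ((n - \<mu>) \<bullet> (n - m)) - (1 / \<gamma>) * ((b - B *v v) \<bullet> (b - b'))"
    by (simp add: r)
  also have "\<dots> = energy \<mu> v (Suc k) - energy \<mu> v (Suc (Suc k)) - step_size (Suc k) / 2"
    unfolding inner_diff_diff_polarization energy_def step_size_def defs[symmetric]
    by (simp add: algebra_simps add_divide_distrib diff_divide_distrib)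
  finally show ?thesis by (simp add: defs)
qed

text \<open>
  Monotonicity of the two subdifferentials between consecutive iterates. The resulting inequality
  has the shape of \<open>energy_inequality\<close> for the increments of \<open>\<nu>\<close> and \<open>B y\<close>, with target \<open>0\<close>; the cross
  term, whose sign is unknown here, is absorbed by the squares of the second differences.
\<close>

lemma step_size_Suc_le: "step_size (Suc (Suc k)) \<le> step_size (Suc k)"
proof -
  define n m b b' where defs: "n = \<nu> (Suc (Suc (Suc k))) - \<nu> (Suc (Suc k))"
    "m = \<nu> (Suc (Suc k)) - \<nu> (Suc k)"
    "b = B *v y (Suc (Suc (Suc k))) - B *v y (Suc (Suc k))"
    "b' = B *v y (Suc (Suc k)) - B *v y (Suc k)"
  have Ax: "A *v x (Suc (Suc (Suc k))) - A *v x (Suc (Suc k)) = \<gamma> *\<^sub>R (n - m) - b"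
  proof -
    have "A *v x (Suc (Suc (Suc k))) - A *v x (Suc (Suc k))
        = residual (Suc (Suc (Suc k))) - residual (Suc (Suc k)) - b"
      by (simp add: residual_def defs)
    then show ?thesis unfolding defs by (simp only: residual_Suc scaleR_diff_right)
  qed
  have "(n + (1 / \<gamma>) *\<^sub>R (b' - b)) \<bullet> (A *v x (Suc (Suc (Suc k))) - A *v x (Suc (Suc k))) \<le> 0"
  proof -
    define p q where "p = \<nu> (Suc (Suc (Suc k)))
          + (1 / \<gamma>) *\<^sub>R (B *v y (Suc (Suc k)) - B *v y (Suc (Suc (Suc k))))"
      and "q = \<nu> (Suc (Suc k)) + (1 / \<gamma>) *\<^sub>R (B *v y (Suc k) - B *v y (Suc (Suc k)))"
    have "(p - q) \<bullet> (A *v x (Suc (Suc (Suc k))) - A *v x (Suc (Suc k))) \<le> 0"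
      using f_subgradient[OF f_iterate[of "Suc k"], of "Suc (Suc k)"]
        f_subgradient[OF f_iterate[of "Suc (Suc k)"], of "Suc k"]
      unfolding p_def[symmetric] q_def[symmetric] inner_diff_left inner_diff_right by linarith
    moreover have "p - q = n + (1 / \<gamma>) *\<^sub>R (b' - b)"
      unfolding p_def q_def defs by (simp add: algebra_simps)
    ultimately show ?thesis by simp
  qed
  moreover have "n \<bullet> b \<le> 0"
    using multiplier_step_inner_nonpos[of "Suc k"] by (simp add: defs)
  ultimately have "(n + (1 / \<gamma>) *\<^sub>R (b' - b)) \<bullet> (\<gamma> *\<^sub>R (n - m) - b) + n \<bullet> b \<le> 0"
    by (simp add: Ax)
  \<comment> \<open>the zeros bring both products into the form \<open>(a - m) \<bullet> (a - n)\<close> for polarization\<close>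
  moreover have "(n + (1 / \<gamma>) *\<^sub>R (b' - b)) \<bullet> (\<gamma> *\<^sub>R (n - m) - b) + n \<bullet> b
      = \<gamma> * ((n - 0) \<bullet> (n - m)) + (1 / \<gamma>) * ((b - 0) \<bullet> (b - b')) - (b - b') \<bullet> (n - m)"
    using \<gamma>_pos by (simp add: inner_simps inner_commute field_simps)
  moreover have "2 * ((b - b') \<bullet> (n - m)) \<le> \<gamma> * (norm (n - m))\<^sup>2 + (norm (b - b'))\<^sup>2 / \<gamma>"
    using \<gamma>_pos by (rule inner_le_weighted_squares)
  ultimately have "\<gamma> * (norm n)\<^sup>2 + (norm b)\<^sup>2 / \<gamma> \<le> \<gamma> * (norm m)\<^sup>2 + (norm b')\<^sup>2 / \<gamma>"
    unfolding inner_diff_diff_polarization by (simp add: algebra_simps add_divide_distrib diff_divide_distrib)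
  then show ?thesis by (simp add: step_size_def defs)
qed

end

section \<open>Convergence under strong duality\<close>

text \<open>
  The pair \<open>(u, v)\<close> is feasible with the finite objective value \<open>s + t\<close>, equal to the dual value. By
  weak duality it is a primal solution.
\<close>

locale admm_run_strong_duality = admm_run +
  fixes u v s t
  assumes f_u: "f u = ereal s" and g_v: "g v = ereal t" and feasible: "A *v u + B *v v = c"
    and duality: "dual_value f g A B c = ereal (s + t)"
begin

lemma near_optimal_multiplier:
  assumes "\<epsilon> > 0"
  shows "\<exists>\<mu>. \<forall>k. s + t - \<epsilon> \<le> objective (Suc k) + \<mu> \<bullet> residual (Suc k)"
proof -
  have "ereal (s + t - \<epsilon>) < dual_value f g A B c" using assms by (simp add: duality)
  then obtain \<mu> where \<mu>: "ereal (s + t - \<epsilon>) < dual_objective f g A B c \<mu>"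
    unfolding dual_value_def less_SUP_iff by blast
  have "ereal (s + t - \<epsilon>) \<le> ereal (objective (Suc k) + \<mu> \<bullet> residual (Suc k))" for k
    unfolding objective_def residual_def
    using \<mu> dual_objective_le_lagrangian[where f=f and g=g, OF f_iterate g_iterate, of A B c \<mu> k k]
    by (meson less_imp_le order_trans)
  then show ?thesis by auto
qed

text \<open>
  With an \<open>\<epsilon>\<close>-optimal multiplier the energy grows by at most \<open>\<epsilon>\<close> per step, so the step sizes have sum
  at most \<open>2 E 1 + 2 K \<epsilon>\<close> over \<open>K\<close> steps. As they are nonincreasing, each is bounded by the average
  of its predecessors. The energy depends on \<open>\<epsilon>\<close> through \<open>\<mu>\<close> and may be unbounded as \<open>\<epsilon>\<close> shrinks, but dividing by
  \<open>K\<close> with \<open>\<epsilon>\<close> fixed removes it.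
\<close>

lemma step_size_tendsto_0: "(\<lambda>k. step_size (Suc k)) \<longlonglongrightarrow> 0"
proof -
  have nonneg: "0 \<le> step_size k" for k using \<gamma>_pos by (simp add: step_size_def)
  have anti: "step_size (Suc k) \<le> step_size (Suc i)" if "i \<le> k" for i k
    using lift_Suc_antimono_le[of "\<lambda>k. step_size (Suc k)", OF step_size_Suc_le that] .
  have "eventually (\<lambda>k. step_size (Suc k) < e) sequentially" if "e > 0" for e
  proof -
    define \<epsilon> where "\<epsilon> = e / 4"
    have "\<epsilon> > 0" using that by (simp add: \<epsilon>_def)
    then obtain \<mu> where \<mu>: "\<And>k. s + t - \<epsilon> \<le> objective (Suc k) + \<mu> \<bullet> residual (Suc k)"
      using near_optimal_multiplier by blast
    have "energy \<mu> v (Suc (Suc k)) + step_size (Suc k) / 2 \<le> energy \<mu> v (Suc k) + \<epsilon>" for k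
      using energy_inequality[OF f_u g_v feasible, of k \<mu>] \<mu>[of "Suc k"] by linarith
    then have "energy \<mu> v (Suc K) + (\<Sum>k<K. step_size (Suc k)) / 2 \<le> energy \<mu> v 1 + real K * \<epsilon>" for K
    proof (induction K)
      case (Suc K)
      from Suc.IH[OF Suc.prems] Suc.prems[of K] show ?case
        by (simp add: algebra_simps add_divide_distrib)
    qed simp
    moreover have "real K * step_size (Suc K) \<le> (\<Sum>k<K. step_size (Suc k))" for K
      using sum_mono[of "{..<K}" "\<lambda>_. step_size (Suc K)" "\<lambda>k. step_size (Suc k)"] anti by simp
    ultimately have bound: "real K * step_size (Suc K) \<le> 2 * energy \<mu> v 1 + 2 * (real K * \<epsilon>)" for K
      using energy_nonneg[of \<mu> v "Suc K"] by (smt (verit) field_sum_of_halves)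
    have "(\<lambda>K. 2 * energy \<mu> v 1 / real K) \<longlonglongrightarrow> 0" by (rule lim_const_over_n)
    then have "eventually (\<lambda>K. 2 * energy \<mu> v 1 / real K < 2 * \<epsilon>) sequentially"
      using \<open>\<epsilon> > 0\<close> by (intro order_tendstoD(2)) auto
    then show ?thesis using eventually_gt_at_top[of 0]
    proof eventually_elim
      case (elim K)
      have "step_size (Suc K) \<le> 2 * energy \<mu> v 1 / real K + 2 * \<epsilon>"
        using bound[of K] elim by (simp add: field_simps)
      with elim show ?case by (simp add: \<epsilon>_def)
    qed
  qed
  then show ?thesis
    using less_le_trans[OF _ nonneg] by (intro order_tendstoI) simp_all
qed

lemma residual_tendsto_0: "residual \<longlonglongrightarrow> 0"
proof -
  have "(norm (residual (Suc (Suc k))))\<^sup>2 \<le> \<gamma> * step_size (Suc k)" for k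
  proof -
    have "(norm (residual (Suc (Suc k))))\<^sup>2 = \<gamma> * (\<gamma> * (norm (\<nu> (Suc (Suc k)) - \<nu> (Suc k)))\<^sup>2)"
      by (simp add: residual_Suc power2_eq_square)
    also have "\<dots> \<le> \<gamma> * step_size (Suc k)"
      using \<gamma>_pos unfolding step_size_def by (intro mult_left_mono) auto
    finally show ?thesis .
  qed
  moreover have "(\<lambda>k. \<gamma> * step_size (Suc k)) \<longlonglongrightarrow> \<gamma> * 0"
    by (intro tendsto_mult_left step_size_tendsto_0)
  ultimately have "(\<lambda>k. (norm (residual (Suc (Suc k))))\<^sup>2) \<longlonglongrightarrow> 0"
    using Lim_null_comparison[of "\<lambda>k. (norm (residual (Suc (Suc k))))\<^sup>2"
        "\<lambda>k. \<gamma> * step_size (Suc k)" sequentially] by simp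
  then have "(\<lambda>k. sqrt ((norm (residual (Suc (Suc k))))\<^sup>2)) \<longlonglongrightarrow> sqrt 0"
    by (rule tendsto_real_sqrt)
  then have "(\<lambda>k. residual (Suc (Suc k))) \<longlonglongrightarrow> 0"
    by (simp add: tendsto_norm_zero_iff)
  then show ?thesis using LIMSEQ_offset[of residual 2 0] by simp
qed

lemma objective_eventually_ge:
  assumes "q < s + t"
  shows "eventually (\<lambda>k. q \<le> objective k) sequentially"
proof -
  define \<epsilon> where "\<epsilon> = (s + t - q) / 2"
  have \<epsilon>: "\<epsilon> > 0" using assms by (simp add: \<epsilon>_def)
  obtain \<mu> where \<mu>: "\<And>k. s + t - \<epsilon> \<le> objective (Suc k) + \<mu> \<bullet> residual (Suc k)"
    using near_optimal_multiplier[OF \<epsilon>] by blast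
  have "(\<lambda>k. \<mu> \<bullet> residual k) \<longlonglongrightarrow> \<mu> \<bullet> 0"
    by (intro tendsto_inner tendsto_const residual_tendsto_0)
  then have "eventually (\<lambda>k. \<mu> \<bullet> residual k < \<epsilon>) sequentially"
    using \<epsilon> by (intro order_tendstoD(2)) auto
  then show ?thesis using eventually_gt_at_top[of 0]
  proof eventually_elim
    case (elim k)
    then obtain j where "k = Suc j" using gr0_conv_Suc by blast
    with elim \<mu>[of j] show ?case by (simp add: \<epsilon>_def field_simps)
  qed
qed

text \<open>
  Telescoping of \<open>energy_inequality\<close> with \<open>\<mu> = 0\<close>. The first objective value is not covered by that
  inequality and enters the constant.
\<close>

lemma sum_objective_le:
  "(\<Sum>i=1..k. objective i) \<le> real k * (s + t) + (\<bar>objective 1 - (s + t)\<bar> + energy 0 v 1)"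
proof -
  have "(\<Sum>i=1..Suc k. objective i) + energy 0 v (Suc k)
      \<le> real (Suc k) * (s + t) + (\<bar>objective 1 - (s + t)\<bar> + energy 0 v 1)" for k
  proof (induction k)
    case (Suc k)
    have "0 \<le> step_size (Suc k)" using \<gamma>_pos by (simp add: step_size_def)
    then show ?case
      using Suc energy_inequality[OF f_u g_v feasible, of k 0] by (simp add: algebra_simps)
  qed simp
  from this[of "k - 1"] show ?thesis
    using energy_nonneg[of 0 v k] energy_nonneg[of 0 v 1] by (cases k) auto
qed

lemma objective_convergence:
  shows "(\<lambda>k. ereal (1 / real k) * (\<Sum>i=1..k. f (x i) + g (y i))) \<longlonglongrightarrow> ereal (s + t)"
    and "liminf (\<lambda>k. f (x k) + g (y k)) = ereal (s + t)"
proof -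
  note lim = average_and_liminf_eq[OF objective_eventually_ge sum_objective_le]
  have obj: "f (x k) + g (y k) = ereal (objective k)" if "k \<ge> 1" for k
    using that objective_iterate[of "k - 1"] by simp
  have "(\<Sum>i=1..k. f (x i) + g (y i)) = ereal (\<Sum>i=1..k. objective i)" for k
    using obj by (simp flip: sum_ereal)
  then show "(\<lambda>k. ereal (1 / real k) * (\<Sum>i=1..k. f (x i) + g (y i))) \<longlonglongrightarrow> ereal (s + t)"
    using lim(1) by simp
  have "liminf (\<lambda>k. f (x k) + g (y k)) = liminf (\<lambda>k. ereal (objective k))"
    by (intro Liminf_eq eventually_mono[OF eventually_ge_at_top[of 1] obj])
  then show "liminf (\<lambda>k. f (x k) + g (y k)) = ereal (s + t)"
    using lim(2) by simp
qed

lemma limit_feasible_and_optimal: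
  assumes "closed_fun f" and "closed_fun g" and "(\<lambda>k. (x k, y k)) \<longlonglongrightarrow> (xs, ys)"
  shows "(xs, ys) \<in> primal_feasible f g A B c" and "f xs + g ys \<le> ereal (s + t)"
proof -
  have xs: "x \<longlonglongrightarrow> xs" and ys: "y \<longlonglongrightarrow> ys"
    using tendsto_fst[OF assms(3)] tendsto_snd[OF assms(3)] by simp_all
  have f: "f xs \<le> liminf (\<lambda>k. f (x k))" and g: "g ys \<le> liminf (\<lambda>k. g (y k))"
    using closed_fun_le_liminf assms xs ys by blast+
  have "f xs + g ys \<le> liminf (\<lambda>k. f (x k)) + liminf (\<lambda>k. g (y k))"
    using f g by (rule add_mono)
  also have "\<dots> \<le> liminf (\<lambda>k. f (x k) + g (y k))"
    using f g f_not_MInfty[of xs] g_not_MInfty[of ys] by (intro ereal_liminf_add_mono) auto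
  finally show le: "f xs + g ys \<le> ereal (s + t)"
    by (simp add: objective_convergence)
  have "residual \<longlonglongrightarrow> A *v xs + B *v ys - c"
    unfolding residual_def
    by (intro tendsto_intros xs ys
        bounded_linear.tendsto[OF matrix_vector_mul_bounded_linear])
  then have "A *v xs + B *v ys = c"
    using LIMSEQ_unique[OF _ residual_tendsto_0] by fastforce
  moreover have "f xs < \<infinity>" "g ys < \<infinity>"
    using le f_not_MInfty[of xs] g_not_MInfty[of ys] by (cases "f xs"; cases "g ys"; simp)+
  ultimately show "(xs, ys) \<in> primal_feasible f g A B c"
    by (simp add: primal_feasible_def eff_dom_def)
qed

end

theorem theorem12:
  fixes f :: "real^'p \<Rightarrow> ereal" and g :: "real^'q \<Rightarrow> ereal"
    and A :: "real^'p^'n" and B :: "real^'q^'n" and c :: "real^'n" and \<gamma> :: real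
    and x :: "nat \<Rightarrow> real^'p" and y :: "nat \<Rightarrow> real^'q" and \<nu> :: "nat \<Rightarrow> real^'n"
  assumes "\<And>u. f u \<noteq> -\<infinity>" and "closed_fun f" and "proper_fun f" and "convex_fun f"
    and "\<And>v. g v \<noteq> -\<infinity>" and "closed_fun g" and "proper_fun g" and "convex_fun g"
    and "\<gamma> > 0"
    and "range ((*v) (transpose A)) \<inter> rel_interior (eff_dom (conjugate f)) \<noteq> {}"
    and "range ((*v) (transpose B)) \<inter> rel_interior (eff_dom (conjugate g)) \<noteq> {}"
    and "admm_iterates f g A B c \<gamma> x y \<nu>"
    and "dual_value f g A B c = primal_value f g A B c"
    and "\<exists>u v. primal_solution f g A B c u v"
    and "\<not> (\<exists>\<mu>. dual_solution f g A B c \<mu>)"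
  shows "((\<lambda>k. A *v x k + B *v y k - c) \<longlonglongrightarrow> 0) \<and>
         ((\<lambda>k. ereal (1 / real k) * (\<Sum>i=1..k. f (x i) + g (y i)))
            \<longlonglongrightarrow> primal_value f g A B c) \<and>
         liminf (\<lambda>k. f (x k) + g (y k)) = primal_value f g A B c \<and>
         (\<forall>xs ys. (\<lambda>k. (x k, y k)) \<longlonglongrightarrow> (xs, ys) \<longrightarrow> primal_solution f g A B c xs ys)"
proof -
  obtain u v where uv: "primal_solution f g A B c u v" using assms(14) by blast
  then have dom: "f u < \<infinity>" "g v < \<infinity>" and feasible: "A *v u + B *v v = c"
    and opt: "f u + g v = primal_value f g A B c"
    by (auto simp: primal_solution_def primal_feasible_def eff_dom_def)
  obtain s t where st: "f u = ereal s" "g v = ereal t"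
    using dom assms(1)[of u] assms(5)[of v] by (cases "f u"; cases "g v") auto
  have p: "primal_value f g A B c = ereal (s + t)" using opt st by simp
  interpret admm_run_strong_duality f g A B c \<gamma> x y \<nu> u v s t
    by unfold_locales (use assms st feasible p in auto)
  have "primal_solution f g A B c xs ys" if "(\<lambda>k. (x k, y k)) \<longlonglongrightarrow> (xs, ys)" for xs ys
  proof -
    note lim = limit_feasible_and_optimal[OF assms(2,6) that]
    have "primal_value f g A B c \<le> f xs + g ys"
      unfolding primal_value_def using lim(1) by (rule INF_lower2) simp
    with lim p show ?thesis by (simp add: primal_solution_def)
  qed
  then show ?thesis
    using residual_tendsto_0 objective_convergence by (auto simp: p residual_def[abs_def])
qed

end
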